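(* For $n\ge2$ let $R_n$ be the linear hexagonal cylinder chain with vertices $p_i,q_i,u_i,v_i$, $i\in\{1,\dots,n\}$ (indices modulo $n$) and edges $p_iq_i$, $p_iu_i$, $u_ip_{i+1}$, $q_iv_i$, $v_iq_{i+1}$ ($1\le i\le n$), and let $\alpha=3-2\sqrt2$. Then $$K\!f(R_n)=\frac{4n^3-n}{3}+3\sqrt2\,n^2\,\frac{1+\alpha^n}{1-\alpha^n}.$$
   Context: The Kirchhoff index of a connected graph $G$ is $K\!f(G)=\sum_{\{u,v\}\subseteq V(G)}r_G(u,v)$, summed over unordered pairs of distinct vertices, where $r_G(u,v)$ is the effective resistance between $u$ and $v$ when each edge is a unit resistor. $R_n$ is the graph obtained from a row of $n$ hexagons by identifying the two opposite lateral edges. *)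

theory Defs
  imports Complex_Main
begin

text \<open>
  A finite simple graph is given by its vertex set \<open>V\<close> and its set \<open>E\<close> of edges, each edge being
  a two-element subset of \<open>V\<close>.
\<close>

definition neighbours :: "'a set \<Rightarrow> 'a set set \<Rightarrow> 'a \<Rightarrow> 'a set" where
  "neighbours V E x = {y \<in> V. {x, y} \<in> E}"

text \<open>
  \<open>f\<close> is an electric potential that drives a unit current into the network at \<open>u\<close> and out of it
  at \<open>v\<close>. By Ohm's law the current along a unit resistor from \<open>x\<close> to \<open>y\<close> is \<open>f x - f y\<close>;
  Kirchhoff's current law says that the net current leaving \<open>x\<close> is the current supplied there
  from outside.
\<close>

definition unit_current_potential ::
    "'a set \<Rightarrow> 'a set set \<Rightarrow> 'a \<Rightarrow> 'a \<Rightarrow> ('a \<Rightarrow> real) \<Rightarrow> bool" where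
  "unit_current_potential V E u v f \<longleftrightarrow>
     (\<forall>x\<in>V. (\<Sum>y\<in>neighbours V E x. f x - f y) =
        (if x = u then 1 else 0) - (if x = v then 1 else 0))"

definition effective_resistance :: "'a set \<Rightarrow> 'a set set \<Rightarrow> 'a \<Rightarrow> 'a \<Rightarrow> real" where
  "effective_resistance V E u v =
     (THE r. \<exists>f. unit_current_potential V E u v f \<and> r = f u - f v)"

text \<open>
  The value is the same for all such potentials, and it is symmetric in the two vertices, so
  that it is determined by the unordered pair.
\<close>

lemma unit_current_potential_diff_unique:
  assumes "finite V" "u \<in> V" "v \<in> V"
    and f: "unit_current_potential V E u v f" and g: "unit_current_potential V E u v g"
  shows "f u - f v = g u - g v"
proof -
  have green: "(\<Sum>x\<in>V. k x * (\<Sum>y\<in>neighbours V E x. h x - h y)) =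
      (\<Sum>x\<in>V. h x * (\<Sum>y\<in>neighbours V E x. k x - k y))" for h k :: "'a \<Rightarrow> real"
  proof -
    have expand: "(\<Sum>x\<in>V. a x * (\<Sum>y\<in>neighbours V E x. b x - b y)) =
        (\<Sum>x\<in>V. \<Sum>y\<in>V. (if {x, y} \<in> E then a x * b x else 0)) -
        (\<Sum>x\<in>V. \<Sum>y\<in>V. (if {x, y} \<in> E then a x * b y else 0))" for a b :: "'a \<Rightarrow> real"
    proof -
      have "a x * (\<Sum>y\<in>neighbours V E x. b x - b y) =
          (\<Sum>y\<in>V. (if {x, y} \<in> E then a x * b x else 0)) -
          (\<Sum>y\<in>V. (if {x, y} \<in> E then a x * b y else 0))" for x
      proof -
        have "a x * (\<Sum>y\<in>neighbours V E x. b x - b y) =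
            (\<Sum>y\<in>V. if {x, y} \<in> E then a x * (b x - b y) else 0)"
          unfolding neighbours_def sum_distrib_left by (rule sum.inter_filter[OF \<open>finite V\<close>])
        also have "\<dots> = (\<Sum>y\<in>V. (if {x, y} \<in> E then a x * b x else 0) -
            (if {x, y} \<in> E then a x * b y else 0))"
          by (rule sum.cong) (auto simp: right_diff_distrib)
        finally show ?thesis
          by (simp only: sum_subtractf)
      qed
      then show ?thesis
        by (simp only: sum_subtractf)
    qed
    have "(\<Sum>x\<in>V. \<Sum>y\<in>V. (if {x, y} \<in> E then k x * h y else 0)) =
        (\<Sum>x\<in>V. \<Sum>y\<in>V. (if {x, y} \<in> E then h x * k y else 0))"
      by (subst sum.swap, intro sum.cong) (auto simp: insert_commute mult.commute)
    moreover have "(\<Sum>x\<in>V. \<Sum>y\<in>V. (if {x, y} \<in> E then k x * h x else 0)) =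
        (\<Sum>x\<in>V. \<Sum>y\<in>V. (if {x, y} \<in> E then h x * k x else 0))"
      by (simp only: mult.commute)
    ultimately show ?thesis
      by (simp only: expand)
  qed
  have pick: "(\<Sum>x\<in>V. k x * (\<Sum>y\<in>neighbours V E x. h x - h y)) = k u - k v"
    if "unit_current_potential V E u v h" for h k :: "'a \<Rightarrow> real"
  proof -
    have "(\<Sum>x\<in>V. k x * (\<Sum>y\<in>neighbours V E x. h x - h y)) =
        (\<Sum>x\<in>V. (if x = u then k x else 0) - (if x = v then k x else 0))"
      using that by (intro sum.cong) (auto simp: unit_current_potential_def)
    then show ?thesis
      using assms(1-3) by (simp add: sum_subtractf)
  qed
  from green[of f g] show ?thesis
    by (simp add: pick[OF f] pick[OF g])
qed

lemma effective_resistance_eq: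
  assumes "finite V" "u \<in> V" "v \<in> V" and f: "unit_current_potential V E u v f"
  shows "effective_resistance V E u v = f u - f v"
  unfolding effective_resistance_def
proof (rule the_equality)
  show "\<exists>g. unit_current_potential V E u v g \<and> f u - f v = g u - g v"
    using f by (intro exI[of _ f]) simp
next
  fix r assume "\<exists>g. unit_current_potential V E u v g \<and> r = g u - g v"
  then obtain g where g: "unit_current_potential V E u v g" "r = g u - g v"
    by blast
  then show "r = f u - f v"
    using unit_current_potential_diff_unique[OF assms(1-3) g(1) f] by simp
qed

lemma effective_resistance_commute:
  "effective_resistance V E u v = effective_resistance V E v u"
proof -
  have neg: "\<exists>f. unit_current_potential V E b a f \<and> r = f b - f a"
    if ex: "\<exists>f. unit_current_potential V E a b f \<and> r = f a - f b" for a b :: 'a and r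
  proof -
    obtain f where f: "unit_current_potential V E a b f" "r = f a - f b"
      using ex by blast
    have "(\<Sum>y\<in>neighbours V E x. - f x - - f y) = - (\<Sum>y\<in>neighbours V E x. f x - f y)" for x
      by (subst sum_negf[symmetric], rule sum.cong) auto
    then have "unit_current_potential V E b a (\<lambda>x. - f x)"
      using f(1) unfolding unit_current_potential_def by auto
    then show ?thesis
      using f(2) by (intro exI[of _ "\<lambda>x. - f x"]) simp
  qed
  have "(\<lambda>r. \<exists>f. unit_current_potential V E u v f \<and> r = f u - f v) =
      (\<lambda>r. \<exists>f. unit_current_potential V E v u f \<and> r = f v - f u)"
    by (intro ext iffI; rule neg; assumption)
  then show ?thesis
    by (simp only: effective_resistance_def)
qed

definition pair_resistance :: "'a set \<Rightarrow> 'a set set \<Rightarrow> 'a set \<Rightarrow> real" where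
  "pair_resistance V E e = (THE r. \<exists>u v. e = {u, v} \<and> r = effective_resistance V E u v)"

lemma pair_resistance_eq: "pair_resistance V E {u, v} = effective_resistance V E u v"
  unfolding pair_resistance_def
proof (rule the_equality)
  fix r assume "\<exists>u' v'. {u, v} = {u', v'} \<and> r = effective_resistance V E u' v'"
  then show "r = effective_resistance V E u v"
    using effective_resistance_commute[of V E u v] by (auto simp: doubleton_eq_iff)
qed blast

definition kirchhoff_index :: "'a set \<Rightarrow> 'a set set \<Rightarrow> real" where
  "kirchhoff_index V E = (\<Sum>e | e \<subseteq> V \<and> card e = 2. pair_resistance V E e)"

text \<open>
  The vertices \<open>p\<^sub>i, q\<^sub>i, u\<^sub>i, v\<^sub>i\<close> of the linear hexagonal cylinder chain \<open>R\<^sub>n\<close>. The index set is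
  \<open>{0, \<dots>, n - 1}\<close>, i.e. the residue \<open>n\<close> is represented by \<open>0\<close>.
\<close>

datatype hex_vertex = Pv nat | Qv nat | Uv nat | Vv nat

definition hex_cylinder_vertices :: "nat \<Rightarrow> hex_vertex set" where
  "hex_cylinder_vertices n = (\<Union>i<n. {Pv i, Qv i, Uv i, Vv i})"

definition hex_cylinder_edges :: "nat \<Rightarrow> hex_vertex set set" where
  "hex_cylinder_edges n =
     (\<Union>i<n. {{Pv i, Qv i}, {Pv i, Uv i}, {Uv i, Pv (Suc i mod n)},
       {Qv i, Vv i}, {Vv i, Qv (Suc i mod n)}})"

end

theory Submission
  imports Defs
begin

text \<open>
  Let \<open>G\<close> be a Green function, i.e. \<open>L G(\<cdot>, y) = \<delta>\<^sub>y - c\<close> for the Laplacian \<open>L\<close>. Then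
  \<open>G(\<cdot>, u) - G(\<cdot>, v)\<close> is a unit current potential, so the Kirchhoff index is
  \<open>|V| tr G - \<Sum> G\<close>. The reflection exchanging \<open>p\<^sub>i, q\<^sub>i\<close> and \<open>u\<^sub>i, v\<^sub>i\<close> splits the Laplacian of
  \<open>R\<^sub>n\<close> into that of the cycle of length \<open>2n\<close> (symmetric functions) and the same matrix with \<open>2\<close>
  added to the diagonal at each \<open>p\<^sub>i\<close> (antisymmetric functions). Both have explicit Green functions:
  a quadratic polynomial in the distance, and, after elimination of the \<open>u\<^sub>i\<close>, the solution of
  \<open>6 a(t) - a(t + 1) - a(t - 1) = 2 \<delta>\<^sub>0\<close> on the integers modulo \<open>n\<close>, whose characteristic roots are
  \<open>3 \<plusminus> 2 \<surd>2\<close>.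
\<close>

section \<open>Green functions and the Kirchhoff index\<close>

text \<open>The constant \<open>c\<close> cancels when two columns of \<open>G\<close> are
  subtracted. Summing over \<open>x\<close> shows that it is one over the number of
  vertices.\<close>

definition is_green_function :: "'a set \<Rightarrow> 'a set set \<Rightarrow> ('a \<Rightarrow> 'a \<Rightarrow> real) \<Rightarrow> bool" where
  "is_green_function V E G \<longleftrightarrow> (\<exists>c. \<forall>x\<in>V. \<forall>y\<in>V.
     (\<Sum>z\<in>neighbours V E x. G x y - G z y) = (if x = y then 1 else 0) - c)"

lemma effective_resistance_green:
  assumes "finite V" "is_green_function V E G" "u \<in> V" "v \<in> V"
  shows "effective_resistance V E u v = G u u + G v v - G u v - G v u"
proof -
  obtain c where c: "\<And>x y. x \<in> V \<Longrightarrow> y \<in> V \<Longrightarrow>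
      (\<Sum>z\<in>neighbours V E x. G x y - G z y) = (if x = y then 1 else 0) - c"
    using assms(2) unfolding is_green_function_def by blast
  have "(\<Sum>z\<in>neighbours V E x. (G x u - G x v) - (G z u - G z v)) =
      (if x = u then 1 else 0) - (if x = v then 1 else 0)" if "x \<in> V" for x
  proof -
    have "(\<Sum>z\<in>neighbours V E x. (G x u - G x v) - (G z u - G z v)) =
        (\<Sum>z\<in>neighbours V E x. G x u - G z u) - (\<Sum>z\<in>neighbours V E x. G x v - G z v)"
      by (simp add: sum_subtractf[symmetric] algebra_simps)
    then show ?thesis
      using c that assms(3,4) by simp
  qed
  then have "unit_current_potential V E u v (\<lambda>x. G x u - G x v)"
    unfolding unit_current_potential_def by simp
  from effective_resistance_eq[OF assms(1,3,4) this] show ?thesis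
    by simp
qed

text \<open>Every two-element set has exactly two preimages under \<open>p\<close> to
  \<open>{fst p, snd p}\<close>.\<close>

lemma sum_ordered_pairs_eq:
  fixes g :: "'a set \<Rightarrow> real"
  assumes "finite V"
  shows "(\<Sum>p | p \<in> V \<times> V \<and> fst p \<noteq> snd p. g {fst p, snd p}) =
    2 * (\<Sum>e | e \<subseteq> V \<and> card e = 2. g e)"
proof -
  let ?D = "{p. p \<in> V \<times> V \<and> fst p \<noteq> snd p}" and ?P = "{e. e \<subseteq> V \<and> card e = 2}"
  let ?e = "\<lambda>p. {fst p, snd p}"
  have fin: "finite ?D" "finite ?P"
    using assms by (auto intro: finite_subset[of _ "V \<times> V"] finite_subset[of _ "Pow V"])
  have "?e ` ?D \<subseteq> ?P"
    by (auto simp: card_2_iff)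
  then have "(\<Sum>p\<in>?D. g (?e p)) = (\<Sum>e\<in>?P. \<Sum>p | p \<in> ?D \<and> ?e p = e. g (?e p))"
    by (rule sum.group[OF fin, symmetric])
  also have "\<dots> = (\<Sum>e\<in>?P. 2 * g e)"
  proof (rule sum.cong[OF refl])
    fix e assume "e \<in> ?P"
    then obtain a b where ab: "e = {a, b}" "a \<noteq> b" "a \<in> V" "b \<in> V"
      by (auto simp: card_2_iff)
    then have "{p. p \<in> ?D \<and> ?e p = e} = {(a, b), (b, a)}"
      by (auto simp: doubleton_eq_iff)
    then show "(\<Sum>p | p \<in> ?D \<and> ?e p = e. g (?e p)) = 2 * g e"
      using ab by (simp add: insert_commute)
  qed
  finally show ?thesis
    by (simp add: sum_distrib_left)
qed

lemma kirchhoff_index_green: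
  assumes fin: "finite V" and G: "is_green_function V E G"
  shows "kirchhoff_index V E = real (card V) * (\<Sum>x\<in>V. G x x) - (\<Sum>x\<in>V. \<Sum>y\<in>V. G x y)"
proof -
  let ?r = "\<lambda>x y. G x x + G y y - G x y - G y x"
  let ?D = "{p. p \<in> V \<times> V \<and> fst p \<noteq> snd p}"
  have "2 * kirchhoff_index V E = (\<Sum>p\<in>?D. pair_resistance V E {fst p, snd p})"
    unfolding kirchhoff_index_def by (rule sum_ordered_pairs_eq[OF fin, symmetric])
  also have "\<dots> = (\<Sum>p\<in>?D. ?r (fst p) (snd p))"
    using effective_resistance_green[OF fin G]
    by (intro sum.cong) (auto simp: pair_resistance_eq)
  \<comment> \<open>The diagonal may be added, since \<open>?r x x\<close> vanishes.\<close>
  also have "\<dots> = (\<Sum>p\<in>V \<times> V. ?r (fst p) (snd p))"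
    using fin by (intro sum.mono_neutral_left) auto
  also have "\<dots> = (\<Sum>x\<in>V. \<Sum>y\<in>V. ?r x y)"
    by (simp add: sum.cartesian_product case_prod_beta)
  also have "\<dots> = 2 * (real (card V) * (\<Sum>x\<in>V. G x x) - (\<Sum>x\<in>V. \<Sum>y\<in>V. G x y))"
    using sum.swap[of "\<lambda>x y. G y x" V V]
    by (simp add: sum.distrib sum_subtractf sum_distrib_left[symmetric])
  finally show ?thesis
    by simp
qed

section \<open>Periodic functions\<close>

text \<open>The symmetry gives \<open>f m = f 0\<close>, so a step up past \<open>m - 1\<close>
  needs no special case, and \<open>f (m - 1) = f 1\<close>, so only residue \<open>0\<close> is
  exceptional. Each Laplacian check is thereby reduced to arithmetic on naturals.\<close>

lemma periodic_neighbours: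
  fixes f :: "nat \<Rightarrow> real"
  assumes m: "m \<ge> 2" and sym: "\<And>r. r \<le> m \<Longrightarrow> f (m - r) = f r"
  defines "r \<equiv> \<lambda>t. nat (t mod int m)"
  shows "f (r (t + 1)) + f (r (t - 1)) =
    (if int m dvd t then 2 * f 1 else f (r t + 1) + f (r t - 1))"
proof -
  define s where "s = t mod int m"
  have s: "0 \<le> s" "s < int m"
    using m by (auto simp: s_def)
  have up: "(t + 1) mod int m = (if s + 1 = int m then 0 else s + 1)"
    using s by (subst mod_add_left_eq[symmetric]) (auto simp: s_def[symmetric])
  have dn: "(t - 1) mod int m = (if s = 0 then int m - 1 else s - 1)"
  proof (cases "s = 0")
    case True
    have "(t - 1) mod int m = (s - 1) mod int m"
      by (simp add: s_def mod_diff_left_eq)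
    also have "\<dots> = int m - 1"
      using True m by (simp add: zmod_minus1)
    finally show ?thesis
      using True by simp
  next
    case False
    have "(t - 1) mod int m = (s - 1) mod int m"
      by (simp add: s_def mod_diff_left_eq)
    then show ?thesis
      using False s by simp
  qed
  have f0: "f m = f 0"
    using sym[of 0] by simp
  have dvd: "int m dvd t \<longleftrightarrow> s = 0"
    by (simp add: s_def dvd_eq_mod_eq_0)
  have up': "f (r (t + 1)) = f (nat s + 1)"
  proof (cases "s + 1 = int m")
    case True
    then have "nat s + 1 = m" using s by linarith
    then show ?thesis using True f0 by (simp add: r_def up)
  next
    case False
    then show ?thesis using s by (simp add: r_def up nat_add_distrib)
  qed
  have dn': "f (r (t - 1)) = (if s = 0 then f 1 else f (nat s - 1))"
  proof (cases "s = 0")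
    case True
    have "nat (int m - 1) = m - 1" using m by simp
    then show ?thesis using True m sym[of 1] by (simp add: r_def dn)
  next
    case False
    then have "nat (s - 1) = nat s - 1" using s by simp
    then show ?thesis using False by (simp add: r_def dn)
  qed
  show ?thesis
    unfolding dvd up' dn' by (auto simp: r_def s_def[symmetric])
qed

lemma nat_mod_eq_0_iff:
  assumes "m \<ge> 2"
  shows "nat (t mod int m) = 0 \<longleftrightarrow> int m dvd t"
proof -
  have "0 \<le> t mod int m"
    using assms by simp
  then show ?thesis
    unfolding dvd_eq_mod_eq_0 by linarith
qed

text \<open>Reflection of the residues about \<open>k\<close> is an involution, hence its own
  inverse in the reindexing.\<close>

lemma sum_periodic_shift:
  fixes f :: "int \<Rightarrow> real"
  assumes "m > 0"
  shows "(\<Sum>l<m. f ((k - int l) mod int m)) = (\<Sum>d<m. f (int d))"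
proof (rule sum.reindex_bij_witness[of _ "\<lambda>d. nat ((k - int d) mod int m)"
      "\<lambda>l. nat ((k - int l) mod int m)"])
qed (use assms in \<open>auto simp: mod_diff_right_eq nat_less_iff\<close>)

text \<open>Minus half the effective resistance \<open>r (m - r) / m\<close> between two vertices of
  the \<open>m\<close>-cycle that are \<open>r\<close> steps apart.\<close>

definition cycle_green :: "nat \<Rightarrow> int \<Rightarrow> real" where
  "cycle_green m t = (let r = real (nat (t mod int m)) in - r * (real m - r) / (2 * real m))"

text \<open>A quadratic has constant second difference, here giving \<open>- 1 / m\<close>; the kink
  at residue \<open>0\<close> adds the unit source.\<close>

lemma cycle_green_laplacian:
  assumes "m \<ge> 2"
  shows "2 * cycle_green m t - cycle_green m (t + 1) - cycle_green m (t - 1) =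
    (if int m dvd t then 1 else 0) - 1 / real m"
proof -
  define f where "f r = - real r * (real m - real r) / (2 * real m)" for r :: nat
  define r where "r = nat (t mod int m)"
  have g: "cycle_green m s = f (nat (s mod int m))" for s
    by (simp add: cycle_green_def f_def Let_def)
  have "f (m - q) = f q" if "q \<le> m" for q
    using that assms by (simp add: f_def field_simps)
  from periodic_neighbours[OF assms, of f, OF this]
  have *: "cycle_green m (t + 1) + cycle_green m (t - 1) =
      (if int m dvd t then 2 * f 1 else f (r + 1) + f (r - 1))"
    by (simp add: g r_def)
  have r0: "r = 0 \<longleftrightarrow> int m dvd t"
    using assms by (simp only: r_def nat_mod_eq_0_iff)
  show ?thesis
  proof (cases "int m dvd t")
    case True
    then have "cycle_green m t = f 0"
      using r0 by (simp add: g r_def)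
    then show ?thesis
      using True * assms by (simp add: f_def field_simps)
  next
    case False
    then have "r > 0" using r0 by simp
    then obtain q where q: "r = Suc q" by (cases r) auto
    have "cycle_green m t = f r"
      by (simp add: g r_def)
    moreover have "2 * f r - (f (r + 1) + f (r - 1)) = - 1 / real m"
      using assms by (simp add: f_def q field_simps)
    ultimately show ?thesis
      using False * by simp
  qed
qed

lemma sum_cycle_green:
  assumes "m > 0"
  shows "(\<Sum>l<m. cycle_green m (k - int l)) = - ((real m)\<^sup>2 - 1) / 12"
proof -
  have "(\<Sum>l<m. cycle_green m (k - int l)) =
      (\<Sum>d<m. - real d * (real m - real d) / (2 * real m))"
    using sum_periodic_shift[OF assms, of "\<lambda>s. - real (nat s) * (real m - real (nat s)) / (2 * real m)" k]
    by (simp add: cycle_green_def Let_def)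
  also have "\<dots> = (\<Sum>d<m. - real d * (real m - real d)) / (2 * real m)"
    by (simp add: sum_divide_distrib)
  \<comment> \<open>The upper bound \<open>M\<close> is decoupled from the factor \<open>c\<close>
    so that induction applies; both are then set to \<open>m\<close>.\<close>
  also have "(\<Sum>d<M. - real d * (c - real d)) =
      - c * (real M * (real M - 1) / 2) + real M * (real M - 1) * (2 * real M - 1) / 6" for M c
    by (induction M) (auto simp: field_simps)
  also have "(- real m * (real m * (real m - 1) / 2) +
      real m * (real m - 1) * (2 * real m - 1) / 6) / (2 * real m) = - ((real m)\<^sup>2 - 1) / 12"
    using assms by (simp add: divide_simps power2_eq_square) (simp add: algebra_simps)
  finally show ?thesis .
qed

text \<open>The sum over all translates by multiples of \<open>n\<close> of
  \<open>sqrt 2 / 4 * \<alpha> ^ |t|\<close>, the decaying solution on the integers; the two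
  geometric series give the closed form.\<close>

definition ladder_green :: "nat \<Rightarrow> int \<Rightarrow> real" where
  "ladder_green n t = (let \<alpha> = 3 - 2 * sqrt 2; r = nat (t mod int n)
     in sqrt 2 / 4 * (\<alpha> ^ r + \<alpha> ^ (n - r)) / (1 - \<alpha> ^ n))"

lemma ladder_green_0:
  assumes "\<alpha> = 3 - 2 * sqrt 2"
  shows "ladder_green n 0 = sqrt 2 / 4 * ((1 + \<alpha> ^ n) / (1 - \<alpha> ^ n))"
  using assms by (simp add: ladder_green_def Let_def)

text \<open>Since \<alpha> is a root of \<open>x * x = 6 * x - 1\<close>, both summands solve the
  homogeneous recurrence away from residue \<open>0\<close>; the source there fixes the factor
  \<open>sqrt 2 / 4 / (1 - \<alpha> ^ n)\<close>.\<close>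

lemma ladder_green_recurrence:
  assumes "n \<ge> 2"
  shows "6 * ladder_green n t - ladder_green n (t + 1) - ladder_green n (t - 1) =
    (if int n dvd t then 2 else 0)"
proof -
  define \<alpha> :: real where "\<alpha> = 3 - 2 * sqrt 2"
  define K where "K = sqrt 2 / 4 / (1 - \<alpha> ^ n)"
  define f where "f r = K * (\<alpha> ^ r + \<alpha> ^ (n - r))" for r :: nat
  define r where "r = nat (t mod int n)"
  have "sqrt 2 < 3 / 2" "1 < sqrt (2 :: real)"
    by (rule real_less_lsqrt; simp add: power2_eq_square) simp
  then have \<alpha>: "0 < \<alpha>" "\<alpha> < 1"
    by (auto simp: \<alpha>_def)
  then have \<alpha>n: "\<alpha> ^ n < 1"
    using assms by (simp add: power_less_one_iff)
  have quad: "\<alpha> * \<alpha> = 6 * \<alpha> - 1"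
    by (simp add: \<alpha>_def algebra_simps)
  have rec: "6 * \<alpha> ^ Suc k = \<alpha> ^ Suc (Suc k) + \<alpha> ^ k" for k
  proof -
    have "\<alpha> ^ Suc (Suc k) = \<alpha> * \<alpha> * \<alpha> ^ k" by simp
    then show ?thesis by (simp add: quad algebra_simps)
  qed
  have g: "ladder_green n s = f (nat (s mod int n))" for s
    by (simp add: ladder_green_def f_def K_def \<alpha>_def Let_def)
  have "f (n - q) = f q" if "q \<le> n" for q
    using that by (simp add: f_def add.commute)
  from periodic_neighbours[OF assms, of f, OF this]
  have *: "ladder_green n (t + 1) + ladder_green n (t - 1) =
      (if int n dvd t then 2 * f 1 else f (r + 1) + f (r - 1))"
    by (simp add: g r_def)
  have r0: "r = 0 \<longleftrightarrow> int n dvd t"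
    using assms by (simp only: r_def nat_mod_eq_0_iff)
  have "r < n"
    using assms by (simp add: r_def nat_less_iff)
  have gt: "ladder_green n t = f r"
    by (simp add: g r_def)
  show ?thesis
  proof (cases "int n dvd t")
    case True
    obtain k where k: "n = Suc k"
      using assms by (cases n) auto
    have "6 - 2 * \<alpha> = 4 * sqrt 2"
      by (simp add: \<alpha>_def)
    \<comment> \<open>As \<open>1 / \<alpha> = 3 + 2 * sqrt 2\<close>, the coefficient
      \<open>6 - 2 / \<alpha>\<close> is the negative of \<open>6 - 2 * \<alpha>\<close>; together
      they produce the factor \<open>1 - \<alpha> ^ n\<close> that cancels the denominator.\<close>
    moreover have "6 * \<alpha> ^ n - 2 * \<alpha> ^ (n - 1) = - (4 * sqrt 2) * \<alpha> ^ n"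
    proof -
      have "6 * \<alpha> ^ n - 2 * \<alpha> ^ (n - 1) = (6 * \<alpha> - 2) * \<alpha> ^ k"
        by (simp add: k left_diff_distrib)
      also have "6 * \<alpha> - 2 = - (4 * sqrt 2) * \<alpha>"
        by (simp add: \<alpha>_def algebra_simps)
      finally show ?thesis
        by (simp add: k)
    qed
    ultimately have "6 * (1 + \<alpha> ^ n) - 2 * (\<alpha> + \<alpha> ^ (n - 1)) = 4 * sqrt 2 * (1 - \<alpha> ^ n)"
      by (simp add: algebra_simps)
    moreover have "6 * f 0 - 2 * f 1 = K * (6 * (1 + \<alpha> ^ n) - 2 * (\<alpha> + \<alpha> ^ (n - 1)))"
      by (simp add: f_def algebra_simps)
    moreover have "K * (4 * sqrt 2 * (1 - \<alpha> ^ n)) = 2"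
    proof -
      have "K * (4 * sqrt 2 * (1 - \<alpha> ^ n)) = 4 * sqrt 2 * (K * (1 - \<alpha> ^ n))"
        by simp
      also have "K * (1 - \<alpha> ^ n) = sqrt 2 / 4"
        using \<alpha>n by (simp add: K_def divide_simps)
      finally show ?thesis
        by simp
    qed
    ultimately have "6 * f 0 - 2 * f 1 = 2"
      by (simp only:)
    then show ?thesis
      using True * gt r0 by simp
  next
    case False
    then obtain q where q: "r = Suc q"
      using r0 by (cases r) auto
    \<comment> \<open>Writing \<open>n = r + 1 + k\<close> removes the truncated subtractions, and
      the powers of \<alpha> counted down from \<open>n\<close> satisfy the same recurrence in
      \<open>k\<close>.\<close>
    obtain k where k: "n = Suc (Suc q + k)"
      using less_imp_Suc_add[OF \<open>r < n\<close>] unfolding q by blast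
    have "n - r = Suc k" "n - (r + 1) = k" "n - (r - 1) = Suc (Suc k)"
      unfolding k q by simp_all
    then have "6 * f r - (f (r + 1) + f (r - 1)) = K *
        ((6 * \<alpha> ^ Suc q - \<alpha> ^ Suc (Suc q) - \<alpha> ^ q) +
         (6 * \<alpha> ^ Suc k - \<alpha> ^ Suc (Suc k) - \<alpha> ^ k))"
      unfolding f_def using q by (simp add: algebra_simps)
    also have "\<dots> = 0"
      by (simp only: rec) simp
    finally show ?thesis
      using False * gt by simp
  qed
qed

lemma cycle_green_cong:
  "s mod int m = t mod int m \<Longrightarrow> cycle_green m s = cycle_green m t"
  by (simp add: cycle_green_def)

lemma ladder_green_cong:
  "s mod int m = t mod int m \<Longrightarrow> ladder_green m s = ladder_green m t"
  by (simp add: ladder_green_def)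

section \<open>The hexagonal cylinder chain\<close>

lemma finite_hex_cylinder_vertices: "finite (hex_cylinder_vertices n)"
  by (simp add: hex_cylinder_vertices_def)

lemma sum_hex_cylinder_vertices:
  fixes f :: "hex_vertex \<Rightarrow> real"
  shows "sum f (hex_cylinder_vertices n) =
    (\<Sum>i<n. f (Pv i) + f (Qv i) + f (Uv i) + f (Vv i))"
proof -
  have "sum f (hex_cylinder_vertices n) = (\<Sum>i<n. sum f {Pv i, Qv i, Uv i, Vv i})"
    unfolding hex_cylinder_vertices_def by (rule sum.UNION_disjoint) auto
  then show ?thesis
    by (simp add: add.assoc)
qed

lemma card_hex_cylinder_vertices: "card (hex_cylinder_vertices n) = 4 * n"
proof -
  have "real (card (hex_cylinder_vertices n)) = real (4 * n)"
    using sum_hex_cylinder_vertices[of "\<lambda>_. 1" n] by simp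
  then show ?thesis
    by (simp only: of_nat_eq_iff)
qed

text \<open>The preceding column is given as \<open>i'\<close> through its successor, which avoids
  subtraction modulo \<open>n\<close>.\<close>

lemma neighbours_hex_cylinder:
  assumes i: "i < n" and i': "i' < n" "Suc i' mod n = i"
  shows "neighbours (hex_cylinder_vertices n) (hex_cylinder_edges n) (Pv i) = {Qv i, Uv i, Uv i'}"
    "neighbours (hex_cylinder_vertices n) (hex_cylinder_edges n) (Qv i) = {Pv i, Vv i, Vv i'}"
    "neighbours (hex_cylinder_vertices n) (hex_cylinder_edges n) (Uv i) = {Pv i, Pv (Suc i mod n)}"
    "neighbours (hex_cylinder_vertices n) (hex_cylinder_edges n) (Vv i) = {Qv i, Qv (Suc i mod n)}"
proof -
  have pred: "Suc j mod n = i \<longleftrightarrow> j = i'" "i = Suc j mod n \<longleftrightarrow> j = i'" if "j < n" for j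
    using that i' by (auto simp: mod_Suc split: if_splits)
  have succ: "Suc i mod n < n"
    using i by simp
  show "neighbours (hex_cylinder_vertices n) (hex_cylinder_edges n) (Pv i) = {Qv i, Uv i, Uv i'}"
    using i i'(1) pred
    by (auto simp: neighbours_def hex_cylinder_vertices_def hex_cylinder_edges_def doubleton_eq_iff)
  show "neighbours (hex_cylinder_vertices n) (hex_cylinder_edges n) (Qv i) = {Pv i, Vv i, Vv i'}"
    using i i'(1) pred
    by (auto simp: neighbours_def hex_cylinder_vertices_def hex_cylinder_edges_def doubleton_eq_iff)
  show "neighbours (hex_cylinder_vertices n) (hex_cylinder_edges n) (Uv i) = {Pv i, Pv (Suc i mod n)}"
    using i succ
    by (auto simp: neighbours_def hex_cylinder_vertices_def hex_cylinder_edges_def doubleton_eq_iff)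
  show "neighbours (hex_cylinder_vertices n) (hex_cylinder_edges n) (Vv i) = {Qv i, Qv (Suc i mod n)}"
    using i succ
    by (auto simp: neighbours_def hex_cylinder_vertices_def hex_cylinder_edges_def doubleton_eq_iff)
qed

section \<open>Coordinates adapted to the reflection, and the Green function of the chain\<close>

fun column :: "hex_vertex \<Rightarrow> int" where
  "column (Pv i) = int i" | "column (Qv i) = int i"
| "column (Uv i) = int i" | "column (Vv i) = int i"

fun is_mid :: "hex_vertex \<Rightarrow> bool" where
  "is_mid (Pv i) = False" | "is_mid (Qv i) = False"
| "is_mid (Uv i) = True" | "is_mid (Vv i) = True"

fun side :: "hex_vertex \<Rightarrow> real" where
  "side (Pv i) = 1" | "side (Qv i) = - 1" | "side (Uv i) = 1" | "side (Vv i) = - 1"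

text \<open>The place on the cycle of length \<open>2 * n\<close> obtained by identifying mirror
  images: even on rungs, odd at degree-two vertices.\<close>

definition position :: "hex_vertex \<Rightarrow> int" where
  "position x = 2 * column x + (if is_mid x then 1 else 0)"

text \<open>
  The mixed entries come from solving for the degree-two vertex between two rungs, whose potential
  is the mean of its neighbours; the factor \<open>2\<close> is the recurrence of \<open>ladder_green\<close> applied to two
  such vertices.
\<close>

definition antisymmetric_green :: "nat \<Rightarrow> hex_vertex \<Rightarrow> hex_vertex \<Rightarrow> real" where
  "antisymmetric_green n x y = (let a = ladder_green n; t = column x - column y in
     if is_mid x then (if is_mid y then 2 * a t else (a t + a (t + 1)) / 2)
     else (if is_mid y then (a t + a (t - 1)) / 2 else a t))"

text \<open>A unit source is half the sum of a symmetric and an antisymmetric pair of sources,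
  whence the division by \<open>2\<close>; at the mirror image of \<open>y\<close> the two sources
  cancel.\<close>

definition hex_green :: "nat \<Rightarrow> hex_vertex \<Rightarrow> hex_vertex \<Rightarrow> real" where
  "hex_green n x y = (cycle_green (2 * n) (position x - position y) +
     side x * side y * antisymmetric_green n x y) / 2"

lemma is_green_function_hex_green:
  assumes n: "n \<ge> 2"
  shows "is_green_function (hex_cylinder_vertices n) (hex_cylinder_edges n) (hex_green n)"
proof -
  let ?N = "neighbours (hex_cylinder_vertices n) (hex_cylinder_edges n)"
  let ?c = "cycle_green (2 * n)" and ?a = "ladder_green n"
  have main: "(\<Sum>z\<in>?N x. hex_green n x y - hex_green n z y) =
      (if x = y then 1 else 0) - 1 / (4 * real n)"
    if x: "x \<in> {Pv i, Qv i, Uv i, Vv i}" and y: "y \<in> {Pv j, Qv j, Uv j, Vv j}"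
      and ij: "i < n" "j < n" for x y i j
  proof -
    define i' where "i' = (if i = 0 then n - 1 else i - 1)"
    \<comment> \<open>As \<open>n \<ge> 2\<close>, adjacent columns differ, so the neighbours listed
      are distinct and the sums over them expand in full.\<close>
    have i': "i' < n" "Suc i' mod n = i" "i' \<noteq> i" "i \<noteq> i'"
      using n ij by (auto simp: i'_def)
    have Suc_ne: "Suc i mod n \<noteq> i" "i \<noteq> Suc i mod n"
      using n ij by (auto simp: mod_Suc)
    define t where "t = int i - int j"
    have t: "int i = t + int j"
      by (simp add: t_def)
    have int_Suc: "int (Suc i mod n) = (int i + 1) mod int n"
      by (simp add: zmod_int add.commute)
    have int_i': "int i' = (int i - 1) mod int n"
      using ij n by (auto simp: i'_def zmod_minus1 of_nat_diff)
    have dvd_t: "int n dvd t \<longleftrightarrow> i = j"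
    proof
      assume "int n dvd t"
      then have "int i mod int n = int j mod int n"
        by (simp add: t_def mod_eq_dvd_iff)
      then show "i = j" using ij by simp
    qed (simp add: t_def)
    have dvd_even: "int (2 * n) dvd 2 * t \<longleftrightarrow> i = j"
      by (simp add: dvd_t[symmetric])
    have even: "even s" if "int (2 * n) dvd s" for s
      using that by (metis dvd_trans dvd_triv_left of_nat_mult of_nat_numeral)
    have dvd_odd: "\<not> int (2 * n) dvd 2 * t + 1" "\<not> int (2 * n) dvd 2 * t - 1"
      using even[of "2 * t + 1"] even[of "2 * t - 1"] by auto
    define d :: real where "d = (if i = j then 1 else 0)"
    define w where "w = 1 / (4 * real n)"
    \<comment> \<open>\<open>C0\<close> serves vertices \<open>x\<close>, \<open>y\<close> of equal
      type; \<open>C1\<close> serves \<open>x\<close> of degree two and \<open>y\<close> on a rung,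
      and \<open>C2\<close> the reverse. In the mixed cases the positions differ by an odd number,
      so there is no source.\<close>
    have C0: "2 * ?c (2 * t) - ?c (2 * t + 1) - ?c (2 * t - 1) =
        d - 2 * w"
      using cycle_green_laplacian[of "2 * n" "2 * t", unfolded dvd_even] n
      by (simp add: w_def d_def)
    have C1: "2 * ?c (2 * t + 1) - ?c (2 * t + 2) - ?c (2 * t) = - 2 * w"
      using cycle_green_laplacian[of "2 * n" "2 * t + 1"] n dvd_odd
      by (simp add: w_def add.commute)
    have C2: "2 * ?c (2 * t - 1) - ?c (2 * t) - ?c (2 * t - 2) = - 2 * w"
      using cycle_green_laplacian[of "2 * n" "2 * t - 1"] n dvd_odd
      by (simp add: w_def add.commute)
    have A: "6 * ?a t - ?a (t + 1) - ?a (t - 1) = 2 * d"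
      using ladder_green_recurrence[OF n, of t] by (simp add: dvd_t d_def)
    \<comment> \<open>This is \<open>hex_green\<close> with the column of \<open>x\<close> replaced
      by any integer \<open>c\<close>; periodicity in \<open>c\<close> then turns the cyclic
      neighbours into \<open>i - 1\<close> and \<open>i + 1\<close>.\<close>
    define g where "g s m c =
        (?c (2 * c + (if m then 1 else 0) - position y) + s * side y *
          (if m then (if is_mid y then 2 * ?a (c - int j) else (?a (c - int j) + ?a (c - int j + 1)) / 2)
           else (if is_mid y then (?a (c - int j) + ?a (c - int j - 1)) / 2 else ?a (c - int j)))) / 2"
      for s m c
    have col: "column y = int j"
      using y by auto
    have g: "hex_green n (Pv k) y = g 1 False (int k)" "hex_green n (Qv k) y = g (- 1) False (int k)"
      "hex_green n (Uv k) y = g 1 True (int k)" "hex_green n (Vv k) y = g (- 1) True (int k)" for k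
      by (simp_all add: hex_green_def g_def antisymmetric_green_def Let_def col position_def[of "_ _"])
    have g_mod: "g s m (c mod int n) = g s m c" for s m c
    proof -
      have "?c (2 * (c mod int n) + b - p) = ?c (2 * c + b - p)" for b p
      proof (rule cycle_green_cong)
        have "2 * (c mod int n) + b - p = (2 * c) mod int (2 * n) + (b - p)"
          using mult_mod_right[of 2 c "int n"] by (simp only: of_nat_mult of_nat_numeral add_diff_eq)
        also have "\<dots> mod int (2 * n) = (2 * c + (b - p)) mod int (2 * n)"
          by (rule mod_add_left_eq)
        also have "2 * c + (b - p) = 2 * c + b - p"
          by simp
        finally show "(2 * (c mod int n) + b - p) mod int (2 * n) = (2 * c + b - p) mod int (2 * n)" .
      qed
      moreover have a: "?a (c mod int n + b) = ?a (c + b)" for b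
        by (rule ladder_green_cong) (rule mod_add_left_eq)
      have "?a (c mod int n - b) = ?a (c - b)" "?a (c mod int n - b + 1) = ?a (c - b + 1)"
        "?a (c mod int n - b - 1) = ?a (c - b - 1)" for b
        using a[of "- b"] a[of "- b + 1"] a[of "- b - 1"] by (simp_all add: algebra_simps)
      ultimately show ?thesis
        by (simp only: g_def)
    qed
    from x consider "x = Pv i" | "x = Qv i" | "x = Uv i" | "x = Vv i"
      by auto
    then show ?thesis
    proof cases
      case 1
      then have "(\<Sum>z\<in>?N x. hex_green n x y - hex_green n z y) =
          3 * g 1 False (int i) - g (- 1) False (int i) - g 1 True (int i) - g 1 True (int i - 1)"
        using i' by (simp add: neighbours_hex_cylinder[OF ij(1) i'(1,2)] g int_i' g_mod)
      then show ?thesis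
        unfolding w_def[symmetric] using y C0 C1 C2 A 1
        by (elim insertE emptyE) (simp_all add: g_def position_def t d_def[symmetric] field_simps)
    next
      case 2
      then have "(\<Sum>z\<in>?N x. hex_green n x y - hex_green n z y) =
          3 * g (- 1) False (int i) - g 1 False (int i) - g (- 1) True (int i) - g (- 1) True (int i - 1)"
        using i' by (simp add: neighbours_hex_cylinder[OF ij(1) i'(1,2)] g int_i' g_mod)
      then show ?thesis
        unfolding w_def[symmetric] using y C0 C1 C2 A 2
        by (elim insertE emptyE) (simp_all add: g_def position_def t d_def[symmetric] field_simps)
    next
      case 3
      then have "(\<Sum>z\<in>?N x. hex_green n x y - hex_green n z y) =
          2 * g 1 True (int i) - g 1 False (int i) - g 1 False (int i + 1)"
        using Suc_ne by (simp add: neighbours_hex_cylinder[OF ij(1) i'(1,2)] g int_Suc g_mod)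
      then show ?thesis
        unfolding w_def[symmetric] using y C0 C1 C2 A 3
        by (elim insertE emptyE) (simp_all add: g_def position_def t d_def[symmetric] field_simps)
    next
      case 4
      then have "(\<Sum>z\<in>?N x. hex_green n x y - hex_green n z y) =
          2 * g (- 1) True (int i) - g (- 1) False (int i) - g (- 1) False (int i + 1)"
        using Suc_ne by (simp add: neighbours_hex_cylinder[OF ij(1) i'(1,2)] g int_Suc g_mod)
      then show ?thesis
        unfolding w_def[symmetric] using y C0 C1 C2 A 4
        by (elim insertE emptyE) (simp_all add: g_def position_def t d_def[symmetric] field_simps)
    qed
  qed
  show ?thesis
    unfolding is_green_function_def
  proof (intro exI[of _ "1 / (4 * real n)"] ballI)
    fix x y assume "x \<in> hex_cylinder_vertices n" "y \<in> hex_cylinder_vertices n"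
    then obtain i j where "i < n" "x \<in> {Pv i, Qv i, Uv i, Vv i}" "j < n" "y \<in> {Pv j, Qv j, Uv j, Vv j}"
      unfolding hex_cylinder_vertices_def by blast
    then show "(\<Sum>z\<in>?N x. hex_green n x y - hex_green n z y) =
        (if x = y then 1 else 0) - 1 / (4 * real n)"
      using main by blast
  qed
qed

section \<open>Row sums and trace of the Green function\<close>

lemma sum_hex_green:
  assumes n: "n \<ge> 2"
  shows "(\<Sum>y\<in>hex_cylinder_vertices n. hex_green n x y) = - (4 * (real n)\<^sup>2 - 1) / 12"
proof -
  have pairs: "(\<Sum>i<M. f (2 * i) + f (2 * i + 1)) = (\<Sum>k<2 * M. f k)"
    for f :: "nat \<Rightarrow> real" and M
    by (induction M) auto
  let ?c = "\<lambda>k. cycle_green (2 * n) (position x - int k)"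
  \<comment> \<open>Over a mirror pair of vertices \<open>y\<close> the antisymmetric parts cancel
    and the two equal cycle parts absorb the factor \<open>1 / 2\<close>.\<close>
  have "(\<Sum>y\<in>hex_cylinder_vertices n. hex_green n x y) = (\<Sum>i<n. ?c (2 * i) + ?c (2 * i + 1))"
    unfolding sum_hex_cylinder_vertices
    by (intro sum.cong) (auto simp: hex_green_def position_def antisymmetric_green_def Let_def field_simps)
  also have "\<dots> = (\<Sum>k<2 * n. ?c k)"
    by (rule pairs)
  finally show ?thesis
    using n by (simp add: sum_cycle_green power_mult_distrib)
qed

text \<open>The cycle part vanishes on the diagonal; each column contributes half of
  \<open>1 + 1 + 2 + 2\<close> copies of \<open>ladder_green n 0\<close>.\<close>

lemma trace_hex_green:
  "(\<Sum>x\<in>hex_cylinder_vertices n. hex_green n x x) = 3 * real n * ladder_green n 0"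
  by (simp add: sum_hex_cylinder_vertices hex_green_def antisymmetric_green_def cycle_green_def
      Let_def)

theorem theorem5p2:
  fixes n :: nat and \<alpha> :: real
  assumes "n \<ge> 2"
    and "\<alpha> = 3 - 2 * sqrt 2"
  shows "kirchhoff_index (hex_cylinder_vertices n) (hex_cylinder_edges n) =
    (4 * real n ^ 3 - real n) / 3 + 3 * sqrt 2 * real n ^ 2 * ((1 + \<alpha> ^ n) / (1 - \<alpha> ^ n))"
proof -
  define H where "H = (1 + \<alpha> ^ n) / (1 - \<alpha> ^ n)"
  \<comment> \<open>The second summand comes from \<open>4 * n\<close> equal row sums, which are
    subtracted and negative.\<close>
  have "kirchhoff_index (hex_cylinder_vertices n) (hex_cylinder_edges n) =
      4 * real n * (3 * real n * ladder_green n 0) + 4 * real n * (4 * (real n)\<^sup>2 - 1) / 12"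
    unfolding kirchhoff_index_green[OF finite_hex_cylinder_vertices
        is_green_function_hex_green[OF assms(1)]]
    by (simp add: sum_hex_green[OF assms(1)] trace_hex_green card_hex_cylinder_vertices)
      (simp add: algebra_simps)
  also have "ladder_green n 0 = sqrt 2 / 4 * H"
    unfolding H_def by (rule ladder_green_0[OF assms(2)])
  finally show ?thesis
    unfolding H_def[symmetric] by (simp add: power2_eq_square power3_eq_cube) (simp add: algebra_simps)
qed

end
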